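(* Let $(M,\omega)$ be a closed surface with an area form. Then two continuous functions $F,G\colon M\to\mathbb{R}$ Poisson commute if and only if there are $F_k,G_k\in C^\infty(M)$, $k\in\mathbb{N}$, such that $F_k\to F$ and $G_k\to G$ in the uniform norm as $k\to\infty$, and $\{F_k,G_k\}\equiv 0$ for all $k$.
   Context: A closed surface is a compact two-dimensional smooth manifold without boundary; an area form is a nowhere vanishing 2-form (which is a symplectic form). $C^\infty(M)$ denotes the real-valued smooth functions on $M$. On a surface with area form $\omega$, the Poisson bracket of $F,G\in C^\infty(M)$ is the function $\{F,G\}\in C^\infty(M)$ defined by $\{F,G\}\,\omega = dF\wedge dG$. The uniform norm is $\|F\|=\sup_{x\in M}|F(x)|$. Definition (Cardin–Viterbo): two continuous functions $F,G\colon M\to\mathbb{R}$ are said to Poisson commute if there are $F_k,G_k\in C^\infty(M)$, $k\in\mathbb{N}$, such that $F_k\to F$, $G_k\to G$ and $\{F_k,G_k\}\to 0$ as $k\to\infty$, all in the uniform norm. *)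

theory Defs
  imports "HOL-Analysis.Analysis"
begin

section \<open>Smooth maps between open subsets of normed spaces\<close>

text \<open>
  For open \<open>S\<close> in a finite-dimensional space, \<open>k_times_differentiable_on S f n\<close> says that \<open>f\<close> is
  of class \<open>C\<^sup>n\<close> on \<open>S\<close>: iterated directional derivatives up to order \<open>n\<close> exist and are continuous.
\<close>

primrec k_times_differentiable_on ::
    "'a::real_normed_vector set \<Rightarrow> ('a \<Rightarrow> 'b::real_normed_vector) \<Rightarrow> nat \<Rightarrow> bool" where
  "k_times_differentiable_on S f 0 \<longleftrightarrow> continuous_on S f"
| "k_times_differentiable_on S f (Suc n) \<longleftrightarrow>
     (\<forall>x\<in>S. f differentiable (at x)) \<and>
     (\<forall>v. k_times_differentiable_on S (\<lambda>x. frechet_derivative f (at x) v) n)"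

definition smooth_on :: "'a::real_normed_vector set \<Rightarrow> ('a \<Rightarrow> 'b::real_normed_vector) \<Rightarrow> bool" where
  "smooth_on S f \<longleftrightarrow> (\<forall>n. k_times_differentiable_on S f n)"

section \<open>Closed surfaces\<close>

text \<open>
  A chart is a pair of its domain and its coordinate map; values of the coordinate map outside the
  domain are irrelevant.
\<close>

type_synonym 'a chart = "'a set \<times> ('a \<Rightarrow> real^2)"

abbreviation chart_dom :: "'a chart \<Rightarrow> 'a set" where
  "chart_dom c \<equiv> fst c"

abbreviation chart_map :: "'a chart \<Rightarrow> 'a \<Rightarrow> real^2" where
  "chart_map c \<equiv> snd c"

definition chart_inv :: "'a chart \<Rightarrow> real^2 \<Rightarrow> 'a" where
  "chart_inv c = inv_into (chart_dom c) (chart_map c)"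

definition is_chart :: "'a topology \<Rightarrow> 'a chart \<Rightarrow> bool" where
  "is_chart M c \<longleftrightarrow>
     openin M (chart_dom c) \<and> open (chart_map c ` chart_dom c) \<and>
     homeomorphic_map (subtopology M (chart_dom c)) (top_of_set (chart_map c ` chart_dom c)) (chart_map c)"

definition transition :: "'a chart \<Rightarrow> 'a chart \<Rightarrow> real^2 \<Rightarrow> real^2" where
  "transition c d = chart_map d \<circ> chart_inv c"

definition smooth_atlas :: "'a topology \<Rightarrow> 'a chart set \<Rightarrow> bool" where
  "smooth_atlas M A \<longleftrightarrow>
     (\<forall>c\<in>A. is_chart M c) \<and> (\<Union>c\<in>A. chart_dom c) = topspace M \<and>
     (\<forall>c\<in>A. \<forall>d\<in>A. smooth_on (chart_map c ` (chart_dom c \<inter> chart_dom d)) (transition c d))"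

text \<open>
  The smooth structure is given by an arbitrary, not necessarily maximal, smooth atlas; smooth
  functions and differential forms do not change when the atlas is enlarged to the maximal one.
  Connectedness is not required.
\<close>

definition closed_surface :: "'a topology \<Rightarrow> 'a chart set \<Rightarrow> bool" where
  "closed_surface M A \<longleftrightarrow>
     Hausdorff_space M \<and> second_countable M \<and> compact_space M \<and> smooth_atlas M A"

definition smooth_function :: "'a chart set \<Rightarrow> ('a \<Rightarrow> real) \<Rightarrow> bool" where
  "smooth_function A F \<longleftrightarrow>
     (\<forall>c\<in>A. smooth_on (chart_map c ` chart_dom c) (F \<circ> chart_inv c))"

section \<open>Differential forms and the Poisson bracket\<close>

text \<open>
  Tangent vectors at \<open>p\<close> are represented by their components in a chart around \<open>p\<close>: for a 2-form
  \<open>\<omega>\<close>, the number \<open>\<omega> c p u v\<close> is the value of \<open>\<omega>\<close> at \<open>p\<close> on the two tangent vectors with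
  components \<open>u\<close> and \<open>v\<close> in the chart \<open>c\<close>. Changing from \<open>c\<close> to \<open>d\<close> transforms components by the
  derivative of the transition map, which gives the compatibility condition in \<open>two_form\<close>.
\<close>

type_synonym 'a form2 = "'a chart \<Rightarrow> 'a \<Rightarrow> real^2 \<Rightarrow> real^2 \<Rightarrow> real"

definition two_form :: "'a chart set \<Rightarrow> 'a form2 \<Rightarrow> bool" where
  "two_form A \<omega> \<longleftrightarrow>
     (\<forall>c\<in>A. \<forall>p\<in>chart_dom c. bilinear (\<omega> c p) \<and> (\<forall>u. \<omega> c p u u = 0)) \<and>
     (\<forall>c\<in>A. \<forall>u v. smooth_on (chart_map c ` chart_dom c) (\<lambda>x. \<omega> c (chart_inv c x) u v)) \<and>
     (\<forall>c\<in>A. \<forall>d\<in>A. \<forall>p\<in>chart_dom c \<inter> chart_dom d. \<forall>u v.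
        \<omega> c p u v = \<omega> d p (frechet_derivative (transition c d) (at (chart_map c p)) u)
                          (frechet_derivative (transition c d) (at (chart_map c p)) v))"

definition area_form :: "'a chart set \<Rightarrow> 'a form2 \<Rightarrow> bool" where
  "area_form A \<omega> \<longleftrightarrow> two_form A \<omega> \<and> (\<forall>c\<in>A. \<forall>p\<in>chart_dom c. \<exists>u v. \<omega> c p u v \<noteq> 0)"

definition differential :: "('a \<Rightarrow> real) \<Rightarrow> 'a chart \<Rightarrow> 'a \<Rightarrow> real^2 \<Rightarrow> real" where
  "differential F c p u = frechet_derivative (F \<circ> chart_inv c) (at (chart_map c p)) u"

definition wedge_differentials :: "('a \<Rightarrow> real) \<Rightarrow> ('a \<Rightarrow> real) \<Rightarrow> 'a form2" where
  "wedge_differentials F G c p u v =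
     differential F c p u * differential G c p v - differential F c p v * differential G c p u"

text \<open>
  \<open>{F,G} \<omega> = dF \<and> dG\<close>, pointwise; the lemma \<open>poisson_bracket_unique\<close> below shows that for smooth
  \<open>F\<close>, \<open>G\<close> the description is proper at every point of the surface.
\<close>

definition poisson_bracket ::
    "'a chart set \<Rightarrow> 'a form2 \<Rightarrow> ('a \<Rightarrow> real) \<Rightarrow> ('a \<Rightarrow> real) \<Rightarrow> 'a \<Rightarrow> real" where
  "poisson_bracket A \<omega> F G p =
     (THE h. \<forall>c\<in>A. p \<in> chart_dom c \<longrightarrow>
        (\<forall>u v. h * \<omega> c p u v = wedge_differentials F G c p u v))"

text \<open>
  Convergence in the uniform norm is the library's \<open>uniform_limit\<close> on the whole surface.
\<close>

definition poisson_commute ::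
    "'a topology \<Rightarrow> 'a chart set \<Rightarrow> 'a form2 \<Rightarrow> ('a \<Rightarrow> real) \<Rightarrow> ('a \<Rightarrow> real) \<Rightarrow> bool" where
  "poisson_commute M A \<omega> F G \<longleftrightarrow>
     (\<exists>Fk Gk :: nat \<Rightarrow> 'a \<Rightarrow> real.
        (\<forall>k. smooth_function A (Fk k)) \<and> (\<forall>k. smooth_function A (Gk k)) \<and>
        uniform_limit (topspace M) Fk F sequentially \<and>
        uniform_limit (topspace M) Gk G sequentially \<and>
        uniform_limit (topspace M) (\<lambda>k. poisson_bracket A \<omega> (Fk k) (Gk k)) (\<lambda>_. 0) sequentially)"

section \<open>The Poisson bracket is well defined\<close>

lemma smooth_on_differentiable:
  assumes "smooth_on S f" "x \<in> S"
  shows "f differentiable (at x)"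
  using assms unfolding smooth_on_def by (metis k_times_differentiable_on.simps(2))

lemma alternating_bilinear_2:
  fixes b :: "real^2 \<Rightarrow> real^2 \<Rightarrow> real"
  assumes "bilinear b" and alt: "\<And>u. b u u = 0"
  shows "b u v = (u$1 * v$2 - u$2 * v$1) * b (axis 1 1) (axis 2 1)"
proof -
  interpret L: linear "\<lambda>x. b x w" for w using assms(1) by (simp add: bilinear_def)
  interpret R: linear "b w" for w using assms(1) by (simp add: bilinear_def)
  have dec: "w = (w$1) *\<^sub>R axis 1 1 + (w$2) *\<^sub>R axis 2 1" for w :: "real^2"
    by (simp add: vec_eq_iff forall_2 axis_def)
  have anti: "b (axis 2 1) (axis 1 1) = - b (axis 1 1) (axis 2 1)"
    using alt[of "axis 1 1 + axis 2 1"] alt[of "axis 1 1"] alt[of "axis 2 1"]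
    by (simp add: L.add R.add)
  have "b u v = b ((u$1) *\<^sub>R axis 1 1 + (u$2) *\<^sub>R axis 2 1) ((v$1) *\<^sub>R axis 1 1 + (v$2) *\<^sub>R axis 2 1)"
    by (rule arg_cong2[where f = b, OF dec dec])
  also have "\<dots> = (u$1 * v$2 - u$2 * v$1) * b (axis 1 1) (axis 2 1)"
    by (simp only: L.add R.add L.scaleR R.scaleR alt anti) (simp add: algebra_simps)
  finally show ?thesis .
qed

lemma chart_inv_left: "is_chart M c \<Longrightarrow> p \<in> chart_dom c \<Longrightarrow> chart_inv c (chart_map c p) = p"
  unfolding is_chart_def chart_inv_def homeomorphic_map_def
  by (metis inv_into_f_f topspace_subtopology_subset openin_subset)

lemma chart_overlap_open:
  assumes "is_chart M c" "is_chart M d"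
  shows "open (chart_map c ` (chart_dom c \<inter> chart_dom d))"
proof -
  have "openin (subtopology M (chart_dom c)) (chart_dom c \<inter> chart_dom d)"
    using assms unfolding is_chart_def by (metis openin_subtopology_Int2)
  moreover have "open_map (subtopology M (chart_dom c)) (top_of_set (chart_map c ` chart_dom c)) (chart_map c)"
    using assms homeomorphic_imp_open_map unfolding is_chart_def by blast
  ultimately have "openin (top_of_set (chart_map c ` chart_dom c)) (chart_map c ` (chart_dom c \<inter> chart_dom d))"
    unfolding open_map_def by blast
  then show ?thesis using assms openin_open_eq unfolding is_chart_def by blast
qed

lemma differential_linear:
  assumes "smooth_function A F" "c \<in> A" "p \<in> chart_dom c"
  shows "linear (differential F c p)"
proof -
  have "(F \<circ> chart_inv c) differentiable (at (chart_map c p))"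
    using assms smooth_on_differentiable unfolding smooth_function_def by blast
  then show ?thesis
    unfolding differential_def by (simp add: linear_frechet_derivative)
qed

lemma differential_transition:
  assumes A: "smooth_atlas M A" and F: "smooth_function A F"
    and c: "c \<in> A" and d: "d \<in> A" and p: "p \<in> chart_dom c \<inter> chart_dom d"
  shows "differential F c p u =
    differential F d p (frechet_derivative (transition c d) (at (chart_map c p)) u)"
proof -
  let ?x = "chart_map c p" and ?t = "transition c d"
  let ?S = "chart_map c ` (chart_dom c \<inter> chart_dom d)"
  have ch: "is_chart M c" "is_chart M d" using A c d by (auto simp: smooth_atlas_def)
  have x: "?x \<in> ?S" using p by blast
  have tx: "?t ?x = chart_map d p" using chart_inv_left[OF ch(1)] p by (simp add: transition_def)
  have "?t differentiable (at ?x)"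
    using A c d x smooth_on_differentiable unfolding smooth_atlas_def by blast
  then have dt: "(?t has_derivative frechet_derivative ?t (at ?x)) (at ?x)"
    by (simp add: frechet_derivative_works)
  have "(F \<circ> chart_inv d) differentiable (at (?t ?x))"
    unfolding tx using F d p smooth_on_differentiable unfolding smooth_function_def by blast
  then have dF: "((F \<circ> chart_inv d) has_derivative frechet_derivative (F \<circ> chart_inv d) (at (?t ?x))) (at (?t ?x))"
    by (simp add: frechet_derivative_works)
  have "((F \<circ> chart_inv d) \<circ> ?t has_derivative
      frechet_derivative (F \<circ> chart_inv d) (at (?t ?x)) \<circ> frechet_derivative ?t (at ?x)) (at ?x)"
    using diff_chain_at[OF dt dF] .
  then have "((F \<circ> chart_inv c) has_derivative
      frechet_derivative (F \<circ> chart_inv d) (at (?t ?x)) \<circ> frechet_derivative ?t (at ?x)) (at ?x)"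
  proof (rule has_derivative_transform_within_open)
    show "open ?S" using chart_overlap_open[OF ch] .
    show "?x \<in> ?S" by (fact x)
    fix y assume "y \<in> ?S"
    then show "((F \<circ> chart_inv d) \<circ> ?t) y = (F \<circ> chart_inv c) y"
      using chart_inv_left[OF ch(1)] chart_inv_left[OF ch(2)] by (auto simp: transition_def)
  qed
  then show ?thesis
    unfolding differential_def tx[symmetric] using frechet_derivative_at by (metis comp_apply)
qed

lemma poisson_bracket_unique:
  assumes S: "closed_surface M A" and w: "area_form A \<omega>"
    and F: "smooth_function A F" and G: "smooth_function A G" and p: "p \<in> topspace M"
  shows "\<exists>!h. \<forall>c\<in>A. p \<in> chart_dom c \<longrightarrow>
    (\<forall>u v. h * \<omega> c p u v = wedge_differentials F G c p u v)"
proof -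
  let ?e = "axis 1 1 :: real^2" and ?f = "axis 2 1 :: real^2"
  have A: "smooth_atlas M A" using S by (simp add: closed_surface_def)
  obtain d where d: "d \<in> A" "p \<in> chart_dom d" using A p unfolding smooth_atlas_def by blast
  have bil: "bilinear (\<omega> d p)" and zero: "\<omega> d p u u = 0" for u
    using w d unfolding area_form_def two_form_def by blast+
  have alt: "\<omega> d p u v = (u$1 * v$2 - u$2 * v$1) * \<omega> d p ?e ?f" for u v
    using bil zero by (rule alternating_bilinear_2)
  have nz: "\<omega> d p ?e ?f \<noteq> 0"
  proof
    assume "\<omega> d p ?e ?f = 0"
    then have "\<omega> d p u v = 0" for u v by (subst alt) simp
    then show False using w d unfolding area_form_def by blast
  qed
  have lin: "linear (differential F d p)" "linear (differential G d p)"
    using differential_linear[OF F d] differential_linear[OF G d] .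
  have walt: "wedge_differentials F G d p u v = (u$1 * v$2 - u$2 * v$1) * wedge_differentials F G d p ?e ?f" for u v
  proof (rule alternating_bilinear_2)
    show "bilinear (wedge_differentials F G d p)"
      unfolding bilinear_def wedge_differentials_def
      by (auto intro!: linearI simp: linear_add[OF lin(1)] linear_add[OF lin(2)]
          linear_scale[OF lin(1)] linear_scale[OF lin(2)] algebra_simps)
  qed (simp add: wedge_differentials_def)
  define h where "h = wedge_differentials F G d p ?e ?f / \<omega> d p ?e ?f"
  have hd: "h * \<omega> d p u v = wedge_differentials F G d p u v" for u v
    using alt[of u v] walt[of u v] nz by (simp add: h_def)
  show ?thesis
  proof (rule ex1I[of _ h])
    show "\<forall>c\<in>A. p \<in> chart_dom c \<longrightarrow> (\<forall>u v. h * \<omega> c p u v = wedge_differentials F G c p u v)"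
    proof (intro ballI impI allI)
      fix c u v assume c: "c \<in> A" "p \<in> chart_dom c"
      let ?D = "frechet_derivative (transition c d) (at (chart_map c p))"
      have "\<omega> c p u v = \<omega> d p (?D u) (?D v)"
        using w c d unfolding area_form_def two_form_def by (metis IntI)
      moreover have "wedge_differentials F G c p u v = wedge_differentials F G d p (?D u) (?D v)"
        using differential_transition[OF A _ c(1) d(1)] F G c d by (simp add: wedge_differentials_def)
      ultimately show "h * \<omega> c p u v = wedge_differentials F G c p u v" using hd by simp
    qed
  next
    fix h' assume "\<forall>c\<in>A. p \<in> chart_dom c \<longrightarrow> (\<forall>u v. h' * \<omega> c p u v = wedge_differentials F G c p u v)"
    then have "h' * \<omega> d p ?e ?f = h * \<omega> d p ?e ?f" using d hd by simp
    then show "h' = h" using nz by simp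
  qed
qed

lemma poisson_bracket:
  assumes "closed_surface M A" "area_form A \<omega>" "smooth_function A F" "smooth_function A G"
    and "c \<in> A" "p \<in> chart_dom c"
  shows "poisson_bracket A \<omega> F G p * \<omega> c p u v = wedge_differentials F G c p u v"
proof -
  have "p \<in> topspace M"
    using assms unfolding closed_surface_def smooth_atlas_def by blast
  from theI'[OF poisson_bracket_unique[OF assms(1-4) this]] show ?thesis
    using assms(5,6) unfolding poisson_bracket_def by blast
qed

end

theory Submission
  imports Defs
begin

text \<open>
  If \<open>{F, G}\<close> is uniformly small, then the image of \<open>(F, G) : M \<rightarrow> \<real>\<^sup>2\<close> has small area, since the
  Jacobian of \<open>(F, G)\<close> in a chart is \<open>{F, G}\<close> times the density of \<open>\<omega>\<close>. Hence some translate of a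
  fixed fine square lattice misses the image. Off the lattice, the plane has a smooth self-map of
  rank at most one at every point which is as close to the identity as the lattice is fine, and the
  components of its composition with \<open>(F, G)\<close> commute.
\<close>

section \<open>Calculus of smooth functions\<close>

text \<open>Points have to be deleted from the plane: by Sard, a smooth map of rank at most one on a
  whole square has an image of area zero, whereas a continuous map near the identity covers a
  smaller square. The deleted lattice is fixed before the approximants: the accuracy and a bound on
  \<open>F\<close>, \<open>G\<close> determine the mesh and the number of lattice points, and only
  then is k taken so large that the area of the image is below the reciprocal of that number. For
  each lattice point the bad translations fill a set of the same area as the image, so a union bound
  in a unit square of translations leaves a good one. The self-map is a staircase in each
  coordinate, and the rises of the two staircases must not overlap. With a fixed width they would
  cross around every lattice point. The width of a rise in x is therefore made to depend on y, and
  conversely: the strips around x = n pi and y = m pi pinch so sharply at the lattice points that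
  they meet nowhere else. Elsewhere at least one coordinate is locally constant.\<close>

lemma k_times_differentiable_on_cong:
  assumes "open S" "\<And>x. x \<in> S \<Longrightarrow> f x = g x" "k_times_differentiable_on S f n"
  shows "k_times_differentiable_on S g n"
  using assms(2,3)
proof (induction n arbitrary: f g)
  case 0
  then show ?case by (simp cong: continuous_on_cong)
next
  case (Suc n)
  \<comment> \<open>The derivative at \<open>x\<close> depends only on values near \<open>x\<close>;
    openness of \<open>S\<close> supplies a neighbourhood on which \<open>f\<close> and
    \<open>g\<close> agree.\<close>
  have D: "(g has_derivative frechet_derivative f (at x)) (at x)" if "x \<in> S" for x
    using has_derivative_transform_within_open[OF _ assms(1) that, of f _ UNIV g] Suc.prems that
    by (auto simp: frechet_derivative_works)
  have "k_times_differentiable_on S (\<lambda>x. frechet_derivative g (at x) v) n" for v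
    by (rule Suc.IH[of "\<lambda>x. frechet_derivative f (at x) v"])
       (use Suc.prems D frechet_derivative_at in \<open>fastforce+\<close>)
  then show ?case using D by (auto simp: differentiable_def)
qed

text \<open>Derivatives are unique, so an explicit formula \<open>f'\<close> may replace
  \<open>frechet_derivative\<close> in the recursion. The closure properties below are inductions
  through this rule.\<close>

lemma k_times_differentiable_on_SucI:
  assumes "open S" "\<And>x. x \<in> S \<Longrightarrow> (f has_derivative f' x) (at x)"
    and "\<And>v. k_times_differentiable_on S (\<lambda>x. f' x v) n"
  shows "k_times_differentiable_on S f (Suc n)"
proof -
  have "k_times_differentiable_on S (\<lambda>x. frechet_derivative f (at x) v) n" for v
    by (rule k_times_differentiable_on_cong[OF assms(1) _ assms(3)[of v]])
       (use assms(2) frechet_derivative_at in fastforce)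
  then show ?thesis using assms(2) by (auto simp: differentiable_def)
qed

lemma k_times_differentiable_on_SucD:
  "k_times_differentiable_on S f (Suc n) \<Longrightarrow> k_times_differentiable_on S f n"
proof (induction n arbitrary: f)
  case 0
  then show ?case
    by (auto intro!: continuous_at_imp_continuous_on differentiable_imp_continuous_within)
next
  case (Suc n)
  then show ?case by (metis k_times_differentiable_on.simps(2))
qed

lemma k_times_differentiable_on_const:
  "open S \<Longrightarrow> k_times_differentiable_on S (\<lambda>x. c) n"
proof (induction n arbitrary: c)
  case (Suc n)
  show ?case
    by (rule k_times_differentiable_on_SucI[where f' = "\<lambda>_ _. 0"]) (use Suc in auto)
qed simp

lemma has_derivative_frechet_derivative:
  "k_times_differentiable_on S f (Suc n) \<Longrightarrow> x \<in> S \<Longrightarrow>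
    (f has_derivative frechet_derivative f (at x)) (at x)"
  by (simp add: frechet_derivative_works)

lemma k_times_differentiable_on_add:
  "open S \<Longrightarrow> k_times_differentiable_on S f n \<Longrightarrow> k_times_differentiable_on S g n \<Longrightarrow>
    k_times_differentiable_on S (\<lambda>x. f x + g x) n"
proof (induction n arbitrary: f g)
  case 0
  then show ?case by (auto intro!: continuous_intros)
next
  case (Suc n)
  show ?case
    by (rule k_times_differentiable_on_SucI[where
          f' = "\<lambda>x v. frechet_derivative f (at x) v + frechet_derivative g (at x) v"])
       (use Suc in \<open>auto intro!: has_derivative_add simp: frechet_derivative_works\<close>)
qed

lemma k_times_differentiable_on_mult:
  fixes f g :: "'a::real_normed_vector \<Rightarrow> real"
  shows "open S \<Longrightarrow> k_times_differentiable_on S f n \<Longrightarrow> k_times_differentiable_on S g n \<Longrightarrow>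
    k_times_differentiable_on S (\<lambda>x. f x * g x) n"
proof (induction n arbitrary: f g)
  case 0
  then show ?case by (auto intro!: continuous_intros)
next
  case (Suc n)
  show ?case
  proof (rule k_times_differentiable_on_SucI)
    show "((\<lambda>x. f x * g x) has_derivative
        (\<lambda>v. f x * frechet_derivative g (at x) v + frechet_derivative f (at x) v * g x)) (at x)"
      if "x \<in> S" for x
      using Suc.prems(2,3) that by (intro has_derivative_mult has_derivative_frechet_derivative)
    show "k_times_differentiable_on S
        (\<lambda>x. f x * frechet_derivative g (at x) v + frechet_derivative f (at x) v * g x) n" for v
      by (intro k_times_differentiable_on_add Suc.IH)
         (use Suc.prems k_times_differentiable_on_SucD in auto)
  qed (fact Suc.prems)
qed

lemma k_times_differentiable_on_minus:
  fixes f :: "'a::real_normed_vector \<Rightarrow> real"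
  assumes "open S" "k_times_differentiable_on S f n"
  shows "k_times_differentiable_on S (\<lambda>x. - f x) n"
  using k_times_differentiable_on_mult[OF assms(1) k_times_differentiable_on_const[OF assms(1), of "-1"] assms(2)]
  by simp

lemma k_times_differentiable_on_diff:
  fixes f g :: "'a::real_normed_vector \<Rightarrow> real"
  assumes "open S" "k_times_differentiable_on S f n" "k_times_differentiable_on S g n"
  shows "k_times_differentiable_on S (\<lambda>x. f x - g x) n"
  using k_times_differentiable_on_add[OF assms(1,2) k_times_differentiable_on_minus[OF assms(1,3)]]
  by simp

text \<open>With an outer function of one real variable the chain rule yields a product of numbers,
  the derivative of \<open>\<phi>\<close> at \<open>f x\<close> times that of \<open>f\<close>. The
  induction hypothesis is applied to the derivative of \<open>\<phi>\<close> with the same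
  \<open>f\<close>, and the product rule finishes.\<close>

lemma k_times_differentiable_on_compose:
  fixes \<phi> :: "real \<Rightarrow> real"
  shows "open S \<Longrightarrow> open T \<Longrightarrow> f ` S \<subseteq> T \<Longrightarrow>
    k_times_differentiable_on T \<phi> n \<Longrightarrow> k_times_differentiable_on S f n \<Longrightarrow>
    k_times_differentiable_on S (\<lambda>x. \<phi> (f x)) n"
proof (induction n arbitrary: \<phi> f)
  case 0
  then show ?case by (auto intro: continuous_on_compose2)
next
  case (Suc n)
  let ?d = "\<lambda>t. frechet_derivative \<phi> (at t) 1"
  show ?case
  proof (rule k_times_differentiable_on_SucI)
    fix x assume x: "x \<in> S"
    have D: "(\<phi> has_derivative frechet_derivative \<phi> (at (f x))) (at (f x))"
      by (rule has_derivative_frechet_derivative[OF Suc.prems(4)]) (use x Suc.prems(3) in blast)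
    have lin: "frechet_derivative \<phi> (at (f x)) s = ?d (f x) * s" for s
      using linear_scale[OF has_derivative_linear[OF D], of s 1] by (metis mult.commute mult_1_right real_scaleR_def)
    show "((\<lambda>x. \<phi> (f x)) has_derivative (\<lambda>v. ?d (f x) * frechet_derivative f (at x) v)) (at x)"
      using has_derivative_compose[OF has_derivative_frechet_derivative[OF Suc.prems(5) x] D]
      by (rule has_derivative_eq_rhs) (rule ext, rule lin)
  next
    fix v
    have "k_times_differentiable_on S (\<lambda>x. ?d (f x)) n"
      by (rule Suc.IH[where \<phi> = ?d])
         (use Suc.prems(1-4) k_times_differentiable_on_SucD[OF Suc.prems(5)] in auto)
    then show "k_times_differentiable_on S (\<lambda>x. ?d (f x) * frechet_derivative f (at x) v) n"
      using Suc.prems by (intro k_times_differentiable_on_mult) auto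
  qed (fact Suc.prems)
qed

lemma k_times_differentiable_on_real_SucI:
  fixes \<phi> :: "real \<Rightarrow> real"
  assumes "open T" "\<And>t. t \<in> T \<Longrightarrow> (\<phi> has_real_derivative \<phi>' t) (at t)"
    and "k_times_differentiable_on T \<phi>' n"
  shows "k_times_differentiable_on T \<phi> (Suc n)"
  by (rule k_times_differentiable_on_SucI[where f' = "\<lambda>t v. \<phi>' t * v"])
     (use assms in \<open>auto simp: has_field_derivative_def
        intro!: k_times_differentiable_on_mult k_times_differentiable_on_const\<close>)

lemma smooth_on_const: "open S \<Longrightarrow> smooth_on S (\<lambda>x. c)"
  by (simp add: smooth_on_def k_times_differentiable_on_const)

lemma smooth_on_add:
  "open S \<Longrightarrow> smooth_on S f \<Longrightarrow> smooth_on S g \<Longrightarrow> smooth_on S (\<lambda>x. f x + g x)"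
  by (simp add: smooth_on_def k_times_differentiable_on_add)

lemma smooth_on_mult:
  fixes f g :: "'a::real_normed_vector \<Rightarrow> real"
  shows "open S \<Longrightarrow> smooth_on S f \<Longrightarrow> smooth_on S g \<Longrightarrow> smooth_on S (\<lambda>x. f x * g x)"
  by (simp add: smooth_on_def k_times_differentiable_on_mult)

lemma smooth_on_compose:
  fixes \<phi> :: "real \<Rightarrow> real"
  shows "open S \<Longrightarrow> open T \<Longrightarrow> f ` S \<subseteq> T \<Longrightarrow> smooth_on T \<phi> \<Longrightarrow> smooth_on S f \<Longrightarrow>
    smooth_on S (\<lambda>x. \<phi> (f x))"
  by (simp add: smooth_on_def k_times_differentiable_on_compose)

lemma smooth_on_diff:
  fixes f g :: "'a::real_normed_vector \<Rightarrow> real"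
  shows "open S \<Longrightarrow> smooth_on S f \<Longrightarrow> smooth_on S g \<Longrightarrow> smooth_on S (\<lambda>x. f x - g x)"
  by (simp add: smooth_on_def k_times_differentiable_on_diff)

lemma smooth_on_sum:
  assumes "open S" "finite I" "\<And>i. i \<in> I \<Longrightarrow> smooth_on S (f i)"
  shows "smooth_on S (\<lambda>x. \<Sum>i\<in>I. f i x)"
  using assms(2,3) by (induction I rule: finite_induct) (auto intro: smooth_on_const smooth_on_add assms(1))

lemma smooth_on_inverse: "smooth_on (- {0}) (inverse :: real \<Rightarrow> real)"
proof -
  have "k_times_differentiable_on (- {0}) (inverse :: real \<Rightarrow> real) n" for n
  proof (induction n)
    case (Suc n)
    show ?case
      by (rule k_times_differentiable_on_real_SucI[where \<phi>' = "\<lambda>t. - (inverse t * inverse t)"])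
         (use Suc in \<open>auto intro!: k_times_differentiable_on_mult k_times_differentiable_on_minus
            derivative_eq_intros\<close>)
  qed (auto intro!: continuous_intros)
  then show ?thesis by (simp add: smooth_on_def)
qed

lemma smooth_on_divide:
  fixes f g :: "'a::real_normed_vector \<Rightarrow> real"
  assumes "open S" "smooth_on S f" "smooth_on S g" "\<And>x. x \<in> S \<Longrightarrow> g x \<noteq> 0"
  shows "smooth_on S (\<lambda>x. f x / g x)"
proof -
  have "smooth_on S (\<lambda>x. inverse (g x))"
    by (rule smooth_on_compose[OF assms(1) _ _ smooth_on_inverse assms(3)]) (use assms(4) in auto)
  from smooth_on_mult[OF assms(1,2) this] show ?thesis by (simp add: divide_inverse)
qed

lemma smooth_on_sin: "smooth_on UNIV (sin :: real \<Rightarrow> real)"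
proof -
  \<comment> \<open>Each of the two functions is, up to sign, the derivative of the other, so they
    share one induction.\<close>
  have "k_times_differentiable_on UNIV (sin :: real \<Rightarrow> real) n \<and>
      k_times_differentiable_on UNIV (cos :: real \<Rightarrow> real) n" for n
  proof (induction n)
    case (Suc n)
    have "k_times_differentiable_on UNIV (sin :: real \<Rightarrow> real) (Suc n)"
      by (rule k_times_differentiable_on_real_SucI[where \<phi>' = cos])
         (use Suc in \<open>auto intro!: derivative_eq_intros\<close>)
    moreover have "k_times_differentiable_on UNIV (cos :: real \<Rightarrow> real) (Suc n)"
      by (rule k_times_differentiable_on_real_SucI[where \<phi>' = "\<lambda>t. - sin t"])
         (use Suc in \<open>auto intro!: derivative_eq_intros k_times_differentiable_on_minus\<close>)
    ultimately show ?case ..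
  qed (auto intro!: continuous_intros)
  then show ?thesis by (simp add: smooth_on_def)
qed

section \<open>A smooth map of rank at most one off a lattice\<close>

text \<open>The classical function exp(-1/t), extended by zero, is the case \<open>k = 0\<close>.
  The powers of 1/t are included so that the linear span of the family is closed under
  differentiation.\<close>

definition flat :: "nat \<Rightarrow> real \<Rightarrow> real" where
  "flat k t = (if t > 0 then inverse t ^ k * exp (- inverse t) else 0)"

lemma flat_pos: "t > 0 \<Longrightarrow> flat k t > 0"
  and flat_nonpos: "t \<le> 0 \<Longrightarrow> flat k t = 0"
  and flat_nonneg: "flat k t \<ge> 0"
  by (auto simp: flat_def)

lemma flat_has_real_derivative:
  "(flat k has_real_derivative flat (k + 2) t - real k * flat (k + 1) t) (at t)"
proof (cases "t = 0")
  case False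
  then consider "t > 0" | "t < 0" by linarith
  then show ?thesis
  proof cases
    case 1
    have "((\<lambda>t. inverse t ^ k * exp (- inverse t)) has_real_derivative
        flat (k + 2) t - real k * flat (k + 1) t) (at t)"
    proof -
      have i: "(inverse has_real_derivative - (inverse t * inverse t)) (at t)"
        using 1 by (auto intro!: derivative_eq_intros)
      \<comment> \<open>The power rule produces the exponent \<open>k - 1\<close> on natural
        numbers, hence the case split on \<open>k\<close>.\<close>
      show ?thesis
        by (rule DERIV_cong[OF DERIV_mult[OF DERIV_power[OF i] DERIV_chain2[OF DERIV_exp DERIV_minus[OF i]]]])
           (use 1 in \<open>cases k; simp add: flat_def algebra_simps\<close>)
    qed
    then show ?thesis
      by (rule has_field_derivative_transform_within_open[where S = "{0<..}"])
         (use 1 in \<open>auto simp: flat_def\<close>)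
  next
    case 2
    have "((\<lambda>t. 0) has_real_derivative flat (k + 2) t - real k * flat (k + 1) t) (at t)"
      using 2 by (simp add: flat_def)
    then show ?thesis
      by (rule has_field_derivative_transform_within_open[where S = "{..<0}"])
         (use 2 in \<open>auto simp: flat_def\<close>)
  qed
next
  case True
  \<comment> \<open>With u = 1/t this is the difference quotient of \<open>flat k\<close> at 0 from
    the right.\<close>
  have "((\<lambda>u. u ^ Suc k / exp u) \<longlongrightarrow> 0) (at_top :: real filter)"
    by (rule tendsto_power_div_exp_0)
  from filterlim_compose[OF this filterlim_inverse_at_top_right]
  have "((\<lambda>t. inverse t ^ Suc k / exp (inverse t)) \<longlongrightarrow> (0::real)) (at_right 0)" .
  then have "((\<lambda>t. flat k t / t) \<longlongrightarrow> 0) (at_right 0)"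
    by (rule Lim_transform_eventually)
       (auto simp: eventually_at_filter flat_def exp_minus field_simps)
  moreover have "((\<lambda>t. flat k t / t) \<longlongrightarrow> 0) (at_left 0)"
    by (rule Lim_transform_eventually[OF tendsto_const]) (auto simp: eventually_at_filter flat_def)
  ultimately have "((\<lambda>t. flat k t / t) \<longlongrightarrow> 0) (at 0)"
    by (simp add: filterlim_split_at)
  then show ?thesis
    using True by (simp add: has_field_derivative_iff flat_def)
qed

lemma smooth_on_flat: "smooth_on UNIV (flat k)"
proof -
  have "k_times_differentiable_on UNIV (flat k) n" for n
  proof (induction n arbitrary: k)
    case 0
    then show ?case
      using DERIV_isCont[OF flat_has_real_derivative] by (auto intro!: continuous_at_imp_continuous_on)
  next
    case (Suc n)
    show ?case
      by (rule k_times_differentiable_on_real_SucI[where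
            \<phi>' = "\<lambda>t. flat (k + 2) t - real k * flat (k + 1) t"])
         (use flat_has_real_derivative[of k] Suc in \<open>auto intro!: k_times_differentiable_on_diff
            k_times_differentiable_on_mult k_times_differentiable_on_const\<close>)
  qed
  then show ?thesis by (simp add: smooth_on_def)
qed

text \<open>A smooth transition from 0 to 1 across the interval from \<open>-w\<close> to
  \<open>w\<close>. The width enters by addition and not as \<open>u / w\<close>, so the formula
  still makes sense at \<open>w = 0\<close>, where it is a jump at \<open>u = 0\<close>.\<close>

definition step :: "real \<Rightarrow> real \<Rightarrow> real" where
  "step w u = flat 0 (w + u) / (flat 0 (w + u) + flat 0 (w - u))"

lemma step_bounds: "0 \<le> step w u" "step w u \<le> 1"
  using flat_nonneg[of 0 "w + u"] flat_nonneg[of 0 "w - u"]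
  by (auto simp: step_def divide_le_eq_1)

text \<open>The strict inequality matters: at \<open>w = u = 0\<close> the quotient is 0/0, which
  evaluates to 0. This value agrees with \<open>step_eq_0\<close>.\<close>

lemma step_eq_1: "0 \<le> w \<Longrightarrow> w < u \<Longrightarrow> step w u = 1"
  using flat_pos[of "w + u" 0] by (simp add: step_def flat_nonpos)

lemma step_eq_0: "u \<le> - w \<Longrightarrow> step w u = 0"
  by (simp add: step_def flat_nonpos)

text \<open>If \<open>w\<close> is nonnegative and \<open>w\<close>, \<open>u\<close> are not both
  zero, then \<open>w + u\<close> or \<open>w - u\<close> is positive, so the denominator does not
  vanish. Points of width zero are thus harmless away from the jump.\<close>

lemma smooth_on_step:
  assumes S: "open S" and sm: "smooth_on S w" "smooth_on S u"
    and nz: "\<And>x. x \<in> S \<Longrightarrow> w x \<ge> 0 \<and> (w x \<noteq> 0 \<or> u x \<noteq> 0)"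
  shows "smooth_on S (\<lambda>x. step (w x) (u x))"
proof -
  have 1: "smooth_on S (\<lambda>x. flat 0 (w x + u x))" "smooth_on S (\<lambda>x. flat 0 (w x - u x))"
    by (rule smooth_on_compose[OF S open_UNIV _ smooth_on_flat];
        use S sm in \<open>auto intro: smooth_on_add smooth_on_diff\<close>)+
  have "flat 0 (w x + u x) + flat 0 (w x - u x) \<noteq> 0" if "x \<in> S" for x
    using flat_pos[of "w x + u x" 0] flat_pos[of "w x - u x" 0] nz[OF that]
      flat_nonneg[of 0 "w x + u x"] flat_nonneg[of 0 "w x - u x"]
    by (smt (verit))
  then show ?thesis unfolding step_def
    by (intro smooth_on_divide smooth_on_add S 1)
qed

text \<open>
  The map \<open>(x, y) \<mapsto> (stair N x y, stair N y x)\<close> collapses the square \<open>[0, N\<pi>]\<^sup>2\<close> minus the points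
  of \<open>\<pi>\<int>\<^sup>2\<close> onto a grid separating these points: \<open>stair N x y\<close> can vary only where
  \<open>\<bar>sin x\<bar> \<le> (sin y)\<^sup>2 / 2\<close>.
\<close>

definition stair :: "nat \<Rightarrow> real \<Rightarrow> real \<Rightarrow> real" where
  "stair N x y = pi * (\<Sum>n<N. step ((sin y)\<^sup>2 / 2) (x - real n * pi))"

text \<open>For nonnegative \<open>z\<close> the summands are the lengths of the parts of [0, z] in
  the unit intervals from n to n + 1.\<close>

lemma sum_clamp:
  fixes z :: real
  shows "(\<Sum>n<N. min (max (z - real n) 0) 1) = min (max z 0) (real N)"
  by (induction N) (auto simp: min_def max_def)

text \<open>The half-width of a rise is at most 1/2, less than pi/2, so in the unit
  \<open>z = x / pi\<close> every step is squeezed between two ramps whose sums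
  \<open>sum_clamp\<close> evaluates.\<close>

lemma stair_approx:
  assumes "0 \<le> x" "x \<le> real N * pi"
  shows "\<bar>stair N x y - x\<bar> \<le> 6"
proof -
  let ?w = "(sin y)\<^sup>2 / 2" and ?s = "\<lambda>n. step ((sin y)\<^sup>2 / 2) (x - real n * pi)"
  have w: "0 \<le> ?w" "?w \<le> 1/2" by (simp_all add: abs_square_le_1)
  have pi: "pi > 3" "pi < 4" using pi_gt3 pi_less_4 by auto
  define z where "z = x / pi"
  have x: "x = z * pi" using pi by (simp add: z_def)
  have z: "0 \<le> z" "z \<le> real N" using assms pi by (auto simp: z_def divide_le_eq)
  \<comment> \<open>In the unit \<open>z\<close>, step n equals 1 beyond n + 1/2 and 0 before n -
    1/2. The lower ramp starts to rise at n + 1/2; the upper ramp has reached 1 at n - 1/2.\<close>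
  have lo: "min (max ((z - 1/2) - real n) 0) 1 \<le> ?s n" for n
  proof (cases "z - 1/2 > real n")
    case True
    then have "(z - real n) * pi > 1/2 * pi" using pi by (intro mult_strict_right_mono) auto
    then have "?w < x - real n * pi" using w pi by (simp add: x algebra_simps)
    then show ?thesis using step_eq_1 w by simp
  qed (use step_bounds in simp)
  have hi: "?s n \<le> min (max ((z + 3/2) - real n) 0) 1" for n
  proof (cases "z + 1/2 < real n")
    case True
    then have "(real n - z) * pi > 1/2 * pi" using pi by (intro mult_strict_right_mono) auto
    then have "x - real n * pi \<le> - ?w" using w pi by (simp add: x algebra_simps)
    then show ?thesis using step_eq_0 by simp
  qed (use step_bounds in simp)
  have "(\<Sum>n<N. min (max ((z - 1/2) - real n) 0) 1) \<le> (\<Sum>n<N. ?s n)"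
    by (rule sum_mono) (rule lo)
  then have "z - 3/2 \<le> (\<Sum>n<N. ?s n)"
    using z unfolding sum_clamp by linarith
  moreover have "(\<Sum>n<N. ?s n) \<le> (\<Sum>n<N. min (max ((z + 3/2) - real n) 0) 1)"
    by (rule sum_mono) (rule hi)
  then have "(\<Sum>n<N. ?s n) \<le> z + 3/2"
    using z unfolding sum_clamp by linarith
  ultimately have "\<bar>(\<Sum>n<N. ?s n) - z\<bar> \<le> 3/2" by linarith
  \<comment> \<open>The error 6 comes from pi < 4 and the deviation 3/2 of the sum.\<close>
  then have "pi * \<bar>(\<Sum>n<N. ?s n) - z\<bar> \<le> 4 * (3/2)"
    using pi by (intro mult_mono) auto
  moreover have "stair N x y - x = pi * ((\<Sum>n<N. ?s n) - z)"
    unfolding stair_def x right_diff_distrib by (simp add: mult.commute)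
  ultimately show ?thesis
    using pi by (simp add: abs_mult)
qed

section \<open>Smoothness and local constancy of the staircase off the lattice\<close>

lemma abs_sin_le_abs_diff: "\<bar>sin x\<bar> \<le> \<bar>x - real n * pi\<bar>"
proof -
  \<comment> \<open>A shift by a multiple of pi changes the sine at most in sign, which reduces the
    claim to the bound of the sine by its argument.\<close>
  have "sin x = sin ((x - real n * pi) + real n * pi)" by simp
  also have "\<dots> = sin (x - real n * pi) * (-1) ^ n"
    unfolding sin_add by (simp add: mult.commute)
  finally have "\<bar>sin x\<bar> = \<bar>sin (x - real n * pi)\<bar>" by (simp add: abs_mult)
  then show ?thesis using abs_sin_x_le_abs_x[of "x - real n * pi"] by simp
qed

text \<open>If both inequalities failed, each of the two absolute sines would be at most half the
  other, as a square of a sine is at most its absolute value; both would vanish. This is why the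
  rises meet only at lattice points.\<close>

lemma sin_dominates:
  fixes x y :: real
  assumes "sin x \<noteq> 0 \<or> sin y \<noteq> 0"
  shows "(sin y)\<^sup>2 / 2 < \<bar>sin x\<bar> \<or> (sin x)\<^sup>2 / 2 < \<bar>sin y\<bar>"
proof -
  have "(sin z)\<^sup>2 \<le> \<bar>sin z\<bar>" for z :: real
    using mult_left_le[of "\<bar>sin z\<bar>" "\<bar>sin z\<bar>"] by (simp add: power2_eq_square)
  from this[of x] this[of y] show ?thesis using assms by linarith
qed

lemma smooth_on_stair:
  assumes S: "open S" and sm: "smooth_on S f" "smooth_on S g"
    and nz: "\<And>x. x \<in> S \<Longrightarrow> sin (f x) \<noteq> 0 \<or> sin (g x) \<noteq> 0"
  shows "smooth_on S (\<lambda>x. stair N (f x) (g x))"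
proof -
  have s: "smooth_on S (\<lambda>x. sin (g x))"
    by (rule smooth_on_compose[OF S open_UNIV _ smooth_on_sin sm(2)]) simp
  have w: "smooth_on S (\<lambda>x. (sin (g x))\<^sup>2 / 2)"
    unfolding power2_eq_square
    by (intro smooth_on_divide smooth_on_mult smooth_on_const S s) simp
  have "smooth_on S (\<lambda>x. step ((sin (g x))\<^sup>2 / 2) (f x - real n * pi))" for n
  proof (intro smooth_on_step smooth_on_diff smooth_on_const S sm w)
    fix x assume "x \<in> S"
    from nz[OF this] abs_sin_le_abs_diff[of "f x" n]
    show "0 \<le> (sin (g x))\<^sup>2 / 2 \<and> ((sin (g x))\<^sup>2 / 2 \<noteq> 0 \<or> f x - real n * pi \<noteq> 0)"
      by auto
  qed
  then show ?thesis unfolding stair_def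
    by (intro smooth_on_mult smooth_on_const smooth_on_sum S) auto
qed

text \<open>By \<open>abs_sin_le_abs_diff\<close>, \<open>f a\<close> lies strictly outside the rise
  at every multiple of pi at once. The strict inequalities persist nearby, where each step stays 0
  or stays 1.\<close>

lemma stair_locally_constant:
  fixes f g :: "'a::real_normed_vector \<Rightarrow> real"
  assumes f: "isCont f a" and g: "isCont g a" and less: "(sin (g a))\<^sup>2 / 2 < \<bar>sin (f a)\<bar>"
  shows "\<forall>\<^sub>F x in nhds a. stair N (f x) (g x) = stair N (f a) (g a)"
proof -
  have f': "(f \<longlongrightarrow> f a) (nhds a)" and g': "(g \<longlongrightarrow> g a) (nhds a)"
    using f g by (simp_all add: isCont_def tendsto_at_iff_tendsto_nhds)
  have ev: "\<forall>\<^sub>F x in nhds a. step ((sin (g x))\<^sup>2 / 2) (f x - real n * pi) =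
      step ((sin (g a))\<^sup>2 / 2) (f a - real n * pi)" for n
  proof -
    have "(sin (g a))\<^sup>2 / 2 < \<bar>f a - real n * pi\<bar>"
      using less abs_sin_le_abs_diff[of "f a" n] by linarith
    then consider "0 < (f a - real n * pi) - (sin (g a))\<^sup>2 / 2"
      | "(f a - real n * pi) + (sin (g a))\<^sup>2 / 2 < 0" by linarith
    then show ?thesis
    proof cases
      case 1
      have "((\<lambda>x. (f x - real n * pi) - (sin (g x))\<^sup>2 / 2) \<longlongrightarrow>
          (f a - real n * pi) - (sin (g a))\<^sup>2 / 2) (nhds a)"
        by (intro tendsto_intros f' g') simp
      from order_tendstoD(1)[OF this 1] show ?thesis
        by eventually_elim (use 1 in \<open>simp add: step_eq_1\<close>)
    next
      case 2
      have "((\<lambda>x. (f x - real n * pi) + (sin (g x))\<^sup>2 / 2) \<longlongrightarrow>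
          (f a - real n * pi) + (sin (g a))\<^sup>2 / 2) (nhds a)"
        by (intro tendsto_intros f' g') simp
      from order_tendstoD(2)[OF this 2] show ?thesis
        by eventually_elim (use 2 in \<open>simp add: step_eq_0\<close>)
    qed
  qed
  have "\<forall>\<^sub>F x in nhds a. \<forall>n\<in>{..<N}. step ((sin (g x))\<^sup>2 / 2) (f x - real n * pi) =
      step ((sin (g a))\<^sup>2 / 2) (f a - real n * pi)"
    using ev by (intro eventually_ball_finite) auto
  then show ?thesis by eventually_elim (simp add: stair_def)
qed

section \<open>The area of the image\<close>

lemma chart_inv_right: "x \<in> chart_map c ` chart_dom c \<Longrightarrow> chart_map c (chart_inv c x) = x"
  and chart_inv_mem: "x \<in> chart_map c ` chart_dom c \<Longrightarrow> chart_inv c x \<in> chart_dom c"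
  by (simp_all add: chart_inv_def f_inv_into_f inv_into_into)

definition pair_map :: "('a \<Rightarrow> real) \<Rightarrow> ('a \<Rightarrow> real) \<Rightarrow> 'a \<Rightarrow> real^2" where
  "pair_map F G p = F p *\<^sub>R axis 1 1 + G p *\<^sub>R axis 2 1"

lemma pair_map_nth: "pair_map F G p $ 1 = F p" "pair_map F G p $ 2 = G p"
  by (simp_all add: pair_map_def axis_def)

text \<open>The Jacobian determinant of the pair in the chart is the bracket times the density of
  \<open>\<omega>\<close>, hence at most \<open>e * W\<close> in absolute value. The area inequality
  for differentiable images holds without injectivity.\<close>

lemma measure_pair_map_chart:
  assumes M: "closed_surface M A" "area_form A \<omega>" and c: "c \<in> A"
    and B: "B \<in> lmeasurable" "B \<subseteq> chart_map c ` chart_dom c"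
    and W: "\<And>x. x \<in> B \<Longrightarrow> \<bar>\<omega> c (chart_inv c x) (axis 1 1) (axis 2 1)\<bar> \<le> W"
    and FG: "smooth_function A F" "smooth_function A G"
    and e: "\<And>p. p \<in> topspace M \<Longrightarrow> \<bar>poisson_bracket A \<omega> F G p\<bar> \<le> e"
  shows "pair_map F G ` chart_inv c ` B \<in> lmeasurable"
    and "measure lebesgue (pair_map F G ` chart_inv c ` B) \<le> e * W * measure lebesgue B"
proof -
  let ?D = "\<lambda>F x. frechet_derivative (F \<circ> chart_inv c) (at x)"
  let ?d = "\<lambda>x v. ?D F x v *\<^sub>R axis 1 1 + ?D G x v *\<^sub>R axis 2 1 :: real^2"
  have D: "(pair_map F G \<circ> chart_inv c has_derivative ?d x) (at x within B)" if x: "x \<in> B" for x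
  proof -
    have "(H \<circ> chart_inv c has_derivative ?D H x) (at x)" if "smooth_function A H" for H
      using that x B(2) c smooth_on_differentiable frechet_derivative_works
      unfolding smooth_function_def by blast
    from this[OF FG(1)] this[OF FG(2)]
    show ?thesis unfolding pair_map_def comp_def
      by (auto intro!: has_derivative_add has_derivative_scaleR_left intro: has_derivative_at_withinI)
  qed
  have det: "\<bar>det (matrix (?d x))\<bar> \<le> e * W" if x: "x \<in> B" for x
  proof -
    let ?p = "chart_inv c x"
    have xU: "x \<in> chart_map c ` chart_dom c" using x B(2) by blast
    note p = chart_inv_mem[OF xU] and [simp] = chart_inv_right[OF xU]
    have pM: "?p \<in> topspace M"
      using M(1) c p unfolding closed_surface_def smooth_atlas_def by blast
    have "det (matrix (?d x)) = wedge_differentials F G c ?p (axis 1 1) (axis 2 1)"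
      unfolding det_2 matrix_def wedge_differentials_def differential_def by (simp add: axis_def)
    also have "\<dots> = poisson_bracket A \<omega> F G ?p * \<omega> c ?p (axis 1 1) (axis 2 1)"
      using poisson_bracket[OF M FG c p] by simp
    also have "\<bar>\<dots>\<bar> \<le> e * W"
      unfolding abs_mult using e[OF pM] W[OF x] by (intro mult_mono) auto
    finally show ?thesis .
  qed
  have "(\<lambda>x. det (matrix (?d x))) \<in> borel_measurable (lebesgue_on B)"
    using B(1) D by (intro borel_measurable_det_Jacobian) auto
  then have int: "(\<lambda>x. \<bar>det (matrix (?d x))\<bar>) integrable_on B"
    using B(1) det by (intro measurable_bounded_by_integrable_imp_integrable[OF _ integrable_on_const[OF B(1)]]) auto
  show "pair_map F G ` chart_inv c ` B \<in> lmeasurable"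
    and "measure lebesgue (pair_map F G ` chart_inv c ` B) \<le> e * W * measure lebesgue B"
    using measurable_bounded_differentiable_image[OF B(1) D int det]
      measure_bounded_differentiable_image[OF B(1) D int det] by (auto simp: image_comp)
qed

text \<open>The order of quantifiers is the point: \<open>V\<close> and \<open>C\<close> are chosen
  before the functions, so finitely many such \<open>V\<close> serve all pairs.\<close>

lemma measure_pair_map_local:
  assumes M: "closed_surface M A" "area_form A \<omega>" and p: "p \<in> topspace M"
  shows "\<exists>V C. openin M V \<and> p \<in> V \<and>
    (\<forall>F G e. smooth_function A F \<longrightarrow> smooth_function A G \<longrightarrow>
      (\<forall>q\<in>topspace M. \<bar>poisson_bracket A \<omega> F G q\<bar> \<le> e) \<longrightarrow>
      pair_map F G ` V \<in> lmeasurable \<and> measure lebesgue (pair_map F G ` V) \<le> C * e)"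
proof -
  obtain c where c: "c \<in> A" "p \<in> chart_dom c"
    using M(1) p unfolding closed_surface_def smooth_atlas_def by blast
  have ch: "is_chart M c" using M(1) c unfolding closed_surface_def smooth_atlas_def by blast
  let ?U = "chart_map c ` chart_dom c"
  have "open ?U" "chart_map c p \<in> ?U" using ch c by (auto simp: is_chart_def)
  then obtain r where r: "r > 0" "cball (chart_map c p) r \<subseteq> ?U"
    using open_contains_cball by blast
  \<comment> \<open>The closed ball inside the chart makes the density bounded on the open ball,
    whose image serves as the neighbourhood.\<close>
  define B where "B = ball (chart_map c p) r"
  have BU: "B \<subseteq> cball (chart_map c p) r" "B \<subseteq> ?U" using r by (auto simp: B_def)
  have "continuous_on ?U (\<lambda>x. \<omega> c (chart_inv c x) (axis 1 1) (axis 2 1))"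
    using M(2) c(1) unfolding area_form_def two_form_def smooth_on_def
    by (metis k_times_differentiable_on.simps(1))
  then have "continuous_on (cball (chart_map c p) r) (\<lambda>x. \<omega> c (chart_inv c x) (axis 1 1) (axis 2 1))"
    using r continuous_on_subset by blast
  then have "bounded ((\<lambda>x. \<omega> c (chart_inv c x) (axis 1 1) (axis 2 1)) ` cball (chart_map c p) r)"
    by (intro compact_imp_bounded compact_continuous_image) auto
  then obtain W where W: "\<And>x. x \<in> B \<Longrightarrow> \<bar>\<omega> c (chart_inv c x) (axis 1 1) (axis 2 1)\<bar> \<le> W"
    using BU(1) unfolding bounded_iff real_norm_def by blast
  have "continuous_map (subtopology M (chart_dom c)) (top_of_set ?U) (chart_map c)"
    using ch homeomorphic_imp_continuous_map unfolding is_chart_def by blast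
  then have "openin (subtopology M (chart_dom c))
      {q \<in> topspace (subtopology M (chart_dom c)). chart_map c q \<in> B}"
    by (rule openin_continuous_map_preimage) (use BU(2) in \<open>auto simp: openin_open B_def\<close>)
  moreover have "openin M (chart_dom c)" using ch by (simp add: is_chart_def)
  moreover have "{q \<in> topspace (subtopology M (chart_dom c)). chart_map c q \<in> B} = chart_inv c ` B"
    using chart_inv_left[OF ch] chart_inv_right[of _ c] chart_inv_mem[of _ c] BU(2)
      openin_subset[OF \<open>openin M (chart_dom c)\<close>]
    by (force simp: image_iff)
  ultimately have "openin M (chart_inv c ` B)"
    using openin_trans_full by metis
  moreover have "p \<in> chart_inv c ` B"
    using chart_inv_left[OF ch c(2)] r(1) by (auto simp: B_def intro!: rev_image_eqI[of "chart_map c p"])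
  moreover have "B \<in> lmeasurable" by (simp add: B_def)
  moreover have "pair_map F G ` chart_inv c ` B \<in> lmeasurable \<and>
      measure lebesgue (pair_map F G ` chart_inv c ` B) \<le> (W * measure lebesgue B) * e"
    if "smooth_function A F" "smooth_function A G"
      "\<forall>q\<in>topspace M. \<bar>poisson_bracket A \<omega> F G q\<bar> \<le> e" for F G e
    using measure_pair_map_chart[OF M c(1) \<open>B \<in> lmeasurable\<close> BU(2) W, of F G e] that
    by (simp add: mult_ac)
  ultimately show ?thesis by blast
qed

lemma measure_pair_map_bound:
  assumes M: "closed_surface M A" "area_form A \<omega>"
  obtains C where "C \<ge> 0"
    and "\<And>F G e. smooth_function A F \<Longrightarrow> smooth_function A G \<Longrightarrow>
      (\<And>q. q \<in> topspace M \<Longrightarrow> \<bar>poisson_bracket A \<omega> F G q\<bar> \<le> e) \<Longrightarrow> e \<ge> 0 \<Longrightarrow>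
      pair_map F G ` topspace M \<in> lmeasurable \<and>
      measure lebesgue (pair_map F G ` topspace M) \<le> C * e"
proof -
  define P where "P = (\<lambda>V C. \<forall>F G e. smooth_function A F \<longrightarrow> smooth_function A G \<longrightarrow>
      (\<forall>q\<in>topspace M. \<bar>poisson_bracket A \<omega> F G q\<bar> \<le> e) \<longrightarrow>
      pair_map F G ` V \<in> lmeasurable \<and> measure lebesgue (pair_map F G ` V) \<le> C * e)"
  obtain V C where VC: "openin M (V p)" "p \<in> V p" "P (V p) (C p)" if "p \<in> topspace M" for p
    using measure_pair_map_local[OF M] unfolding P_def by metis
  have "compactin M (topspace M)"
    using M(1) by (simp add: closed_surface_def compact_space_def)
  then obtain \<F> where "finite \<F>" "\<F> \<subseteq> V ` topspace M" "topspace M \<subseteq> \<Union>\<F>"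
    using VC(1,2) compactinD[of M "topspace M" "V ` topspace M"] by blast
  then obtain I where I: "finite I" "I \<subseteq> topspace M" "topspace M \<subseteq> (\<Union>p\<in>I. V p)"
    by (metis finite_subset_image)
  have V_sub: "V p \<subseteq> topspace M" if "p \<in> I" for p
    using VC(1) I(2) that openin_subset by blast
  have cover: "topspace M = (\<Union>p\<in>I. V p)"
    using I(3) V_sub by blast
  show thesis
  proof (rule that[of "\<Sum>p\<in>I. \<bar>C p\<bar>"])
    fix F G e assume FG: "smooth_function A F" "smooth_function A G"
      and e: "\<And>q. q \<in> topspace M \<Longrightarrow> \<bar>poisson_bracket A \<omega> F G q\<bar> \<le> e" "e \<ge> 0"
    have loc: "pair_map F G ` V p \<in> lmeasurable" "measure lebesgue (pair_map F G ` V p) \<le> \<bar>C p\<bar> * e"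
      if "p \<in> I" for p
    proof -
      have "P (V p) (C p)" using VC(3) I(2) that by blast
      then have *: "pair_map F G ` V p \<in> lmeasurable" "measure lebesgue (pair_map F G ` V p) \<le> C p * e"
        using FG e(1) unfolding P_def by blast+
      show "pair_map F G ` V p \<in> lmeasurable" by fact
      \<comment> \<open>The local lemma says nothing about the sign of \<open>C p\<close>; absolute
        values make the constants summable to a nonnegative \<open>C\<close>.\<close>
      have "C p * e \<le> \<bar>C p\<bar> * e" using e(2) by (intro mult_right_mono) auto
      with *(2) show "measure lebesgue (pair_map F G ` V p) \<le> \<bar>C p\<bar> * e" by linarith
    qed
    have im: "pair_map F G ` topspace M = (\<Union>p\<in>I. pair_map F G ` V p)"
      unfolding cover by blast
    have "measure lebesgue (pair_map F G ` topspace M) \<le> (\<Sum>p\<in>I. measure lebesgue (pair_map F G ` V p))"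
      unfolding im by (rule measure_UNION_le) (use I loc in auto)
    also have "\<dots> \<le> (\<Sum>p\<in>I. \<bar>C p\<bar> * e)" by (rule sum_mono) (rule loc)
    finally show "pair_map F G ` topspace M \<in> lmeasurable \<and>
        measure lebesgue (pair_map F G ` topspace M) \<le> (\<Sum>p\<in>I. \<bar>C p\<bar>) * e"
      unfolding im using loc I by (auto intro: fmeasurable.finite_UN simp: sum_distrib_right)
  qed (simp add: sum_nonneg)
qed

section \<open>Moving a finite point set off a set of small area\<close>

lemma translated_lattice_avoids:
  fixes K :: "(real^2) set" and v :: "'i \<Rightarrow> real^2"
  assumes K: "K \<in> lmeasurable" and I: "finite I" "real (card I) * measure lebesgue K < 1"
  obtains t where "t \<in> cbox a (a + 1)" "\<And>i. i \<in> I \<Longrightarrow> t + v i \<notin> K"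
proof -
  \<comment> \<open>The translations \<open>t\<close> that carry the point \<open>v i\<close> into
    \<open>K\<close> form a translate of \<open>K\<close>. Together these sets have measure below 1
    and cannot cover the unit square \<open>cbox a (a + 1)\<close>.\<close>
  let ?T = "\<lambda>i. (\<lambda>z. - v i + z) ` K"
  have T: "?T i \<in> lmeasurable" "measure lebesgue (?T i) = measure lebesgue K" for i
    by (rule measurable_translation[OF K], rule measure_translation)
  have "measure lebesgue (\<Union>i\<in>I. ?T i) \<le> (\<Sum>i\<in>I. measure lebesgue (?T i))"
    by (rule measure_UNION_le) (use I T in auto)
  also have "\<dots> < 1" unfolding T(2) using I(2) by simp
  finally have lt: "measure lebesgue (\<Union>i\<in>I. ?T i) < 1" .
  have one: "measure lebesgue (cbox a (a + 1)) = 1"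
    by (simp add: content_cbox_cart interval_ne_empty_cart)
  have "\<not> cbox a (a + 1) \<subseteq> (\<Union>i\<in>I. ?T i)"
  proof
    assume "cbox a (a + 1) \<subseteq> (\<Union>i\<in>I. ?T i)"
    then have "measure lebesgue (cbox a (a + 1)) \<le> measure lebesgue (\<Union>i\<in>I. ?T i)"
      by (rule measure_mono_fmeasurable) (use I T in \<open>auto intro: fmeasurable.finite_UN\<close>)
    then show False using lt one by simp
  qed
  then obtain t where "t \<in> cbox a (a + 1)" "t \<notin> (\<Union>i\<in>I. ?T i)" by blast
  moreover have "t + v i \<notin> K" if "i \<in> I" for i
    using calculation(2) that by (force simp: image_iff)
  ultimately show thesis using that by blast
qed

section \<open>Approximation by commuting functions\<close>

lemma smooth_function_continuous:
  assumes "smooth_function A F" "c \<in> A" "x \<in> chart_map c ` chart_dom c"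
  shows "isCont (F \<circ> chart_inv c) x"
  using assms smooth_on_differentiable differentiable_imp_continuous_within
  unfolding smooth_function_def by blast

lemma smooth_function_cmult_add:
  assumes A: "smooth_atlas M A" and F: "smooth_function A F"
  shows "smooth_function A (\<lambda>p. s + d * F p)"
  unfolding smooth_function_def comp_def
proof
  fix c assume c: "c \<in> A"
  then have "open (chart_map c ` chart_dom c)"
    using A by (auto simp: smooth_atlas_def is_chart_def)
  moreover have "smooth_on (chart_map c ` chart_dom c) (\<lambda>x. F (chart_inv c x))"
    using F c by (simp add: smooth_function_def comp_def)
  ultimately show "smooth_on (chart_map c ` chart_dom c) (\<lambda>x. s + d * F (chart_inv c x))"
    by (intro smooth_on_add smooth_on_mult smooth_on_const)
qed

lemma smooth_function_stair:
  assumes A: "smooth_atlas M A" and F: "smooth_function A F" and G: "smooth_function A G"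
    and nz: "\<And>p. p \<in> topspace M \<Longrightarrow> sin (F p) \<noteq> 0 \<or> sin (G p) \<noteq> 0"
  shows "smooth_function A (\<lambda>p. stair N (F p) (G p))"
  unfolding smooth_function_def comp_def
proof
  fix c assume c: "c \<in> A"
  show "smooth_on (chart_map c ` chart_dom c) (\<lambda>x. stair N (F (chart_inv c x)) (G (chart_inv c x)))"
  proof (rule smooth_on_stair)
    show "open (chart_map c ` chart_dom c)"
      using A c by (auto simp: smooth_atlas_def is_chart_def)
    show "smooth_on (chart_map c ` chart_dom c) (\<lambda>x. F (chart_inv c x))"
      "smooth_on (chart_map c ` chart_dom c) (\<lambda>x. G (chart_inv c x))"
      using F G c by (simp_all add: smooth_function_def comp_def)
    fix x assume "x \<in> chart_map c ` chart_dom c"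
    then have "chart_inv c x \<in> topspace M"
      using chart_inv_mem[of x c] A c unfolding smooth_atlas_def by blast
    then show "sin (F (chart_inv c x)) \<noteq> 0 \<or> sin (G (chart_inv c x)) \<noteq> 0" by (rule nz)
  qed
qed

lemma differential_eq_0:
  assumes "\<forall>\<^sub>F x in nhds (chart_map c p). F (chart_inv c x) = k"
  shows "differential F c p v = 0"
proof -
  obtain S where S: "open S" "chart_map c p \<in> S" "\<And>x. x \<in> S \<Longrightarrow> F (chart_inv c x) = k"
    using assms unfolding eventually_nhds by blast
  have "((\<lambda>_. k) has_derivative (\<lambda>_. 0)) (at (chart_map c p))" by simp
  then have "(F \<circ> chart_inv c has_derivative (\<lambda>_. 0)) (at (chart_map c p))"
    by (rule has_derivative_transform_within_open[OF _ S(1,2)]) (simp add: S(3))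
  then have "frechet_derivative (F \<circ> chart_inv c) (at (chart_map c p)) = (\<lambda>_. 0)"
    using frechet_derivative_at by metis
  then show ?thesis by (simp add: differential_def)
qed

text \<open>At each point \<open>sin_dominates\<close> selects one of the two functions that is
  constant nearby, so its differential kills the wedge. Nondegeneracy of \<open>\<omega>\<close>
  then gives a zero bracket.\<close>

lemma poisson_bracket_stair:
  assumes M: "closed_surface M A" "area_form A \<omega>"
    and FG: "smooth_function A F" "smooth_function A G"
    and nz: "\<And>p. p \<in> topspace M \<Longrightarrow> sin (F p) \<noteq> 0 \<or> sin (G p) \<noteq> 0"
    and p: "p \<in> topspace M"
  shows "poisson_bracket A \<omega> (\<lambda>p. s + d * stair N (F p) (G p)) (\<lambda>p. t + d * stair N (G p) (F p)) p = 0"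
    (is "poisson_bracket A \<omega> ?F ?G p = 0")
proof -
  have A: "smooth_atlas M A" using M(1) by (simp add: closed_surface_def)
  obtain c where c: "c \<in> A" "p \<in> chart_dom c"
    using A p unfolding smooth_atlas_def by blast
  have "is_chart M c" using A c(1) unfolding smooth_atlas_def by blast
  then have inv: "chart_inv c (chart_map c p) = p" using c(2) by (rule chart_inv_left)
  have cont: "isCont (\<lambda>x. F (chart_inv c x)) (chart_map c p)" "isCont (\<lambda>x. G (chart_inv c x)) (chart_map c p)"
    using smooth_function_continuous[OF FG(1) c(1)] smooth_function_continuous[OF FG(2) c(1)] c(2)
    by (simp_all add: comp_def)
  have sm: "smooth_function A ?F" "smooth_function A ?G"
    using nz by (auto intro!: smooth_function_cmult_add[OF A] smooth_function_stair[OF A] FG)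
  obtain u v where uv: "\<omega> c p u v \<noteq> 0"
    using M(2) c unfolding area_form_def by blast
  have "(\<forall>v. differential ?F c p v = 0) \<or> (\<forall>v. differential ?G c p v = 0)"
    using sin_dominates[OF nz[OF p]]
  proof
    assume "(sin (G p))\<^sup>2 / 2 < \<bar>sin (F p)\<bar>"
    then have "\<forall>\<^sub>F x in nhds (chart_map c p).
        stair N (F (chart_inv c x)) (G (chart_inv c x)) = stair N (F p) (G p)"
      using stair_locally_constant[OF cont, of N] by (simp add: inv)
    then have "\<forall>\<^sub>F x in nhds (chart_map c p). ?F (chart_inv c x) = ?F p"
      by eventually_elim simp
    from differential_eq_0[where F = ?F, OF this] show ?thesis by blast
  next
    assume "(sin (F p))\<^sup>2 / 2 < \<bar>sin (G p)\<bar>"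
    then have "\<forall>\<^sub>F x in nhds (chart_map c p).
        stair N (G (chart_inv c x)) (F (chart_inv c x)) = stair N (G p) (F p)"
      using stair_locally_constant[OF cont(2,1), of N] by (simp add: inv)
    then have "\<forall>\<^sub>F x in nhds (chart_map c p). ?G (chart_inv c x) = ?G p"
      by eventually_elim simp
    from differential_eq_0[where F = ?G, OF this] show ?thesis by blast
  qed
  then have "wedge_differentials ?F ?G c p u v = 0"
    by (auto simp: wedge_differentials_def)
  then show ?thesis
    using poisson_bracket[OF M sm c, of u v] uv by simp
qed

section \<open>From almost commuting to commuting pairs\<close>

lemma sin_eq_0_nat:
  assumes "sin x = 0" "0 \<le> x" "x \<le> real N * pi"
  obtains n where "n \<le> N" "x = real n * pi"
proof -
  obtain i :: int where i: "x = of_int i * pi"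
    using assms(1) sin_zero_iff_int2 by blast
  then have "0 \<le> i" "i \<le> int N"
    using assms(2,3) pi_gt_zero by (auto simp: zero_le_mult_iff)
  then show thesis using that[of "nat i"] i by simp
qed

lemma exists_commuting_near:
  assumes M: "closed_surface M A" "area_form A \<omega>"
    and FG: "smooth_function A F" "smooth_function A G"
    and R: "\<And>p. p \<in> topspace M \<Longrightarrow> \<bar>F p\<bar> \<le> R" "\<And>p. p \<in> topspace M \<Longrightarrow> \<bar>G p\<bar> \<le> R"
    and d: "d > 0" "2 * R + 1 \<le> d * (real N * pi)"
    and K: "pair_map F G ` topspace M \<in> lmeasurable"
      "(real N + 1)\<^sup>2 * measure lebesgue (pair_map F G ` topspace M) < 1"
  obtains F' G' where "smooth_function A F'" "smooth_function A G'"
    "\<And>p. p \<in> topspace M \<Longrightarrow> \<bar>F' p - F p\<bar> \<le> 6 * d"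
    "\<And>p. p \<in> topspace M \<Longrightarrow> \<bar>G' p - G p\<bar> \<le> 6 * d"
    "\<And>p. p \<in> topspace M \<Longrightarrow> poisson_bracket A \<omega> F' G' p = 0"
proof -
  have A: "smooth_atlas M A" using M(1) by (simp add: closed_surface_def)
  \<comment> \<open>Here \<open>pair_map\<close> serves only to form a vector from two numbers, with
    \<open>()\<close> as a dummy point.\<close>
  let ?v = "\<lambda>(i, j). pair_map (\<lambda>_. d * (real i * pi)) (\<lambda>_. d * (real j * pi)) () :: real^2"
  have "real (card ({..N} \<times> {..N})) = (real N + 1)\<^sup>2"
    by (simp add: card_cartesian_product power2_eq_square algebra_simps)
  \<comment> \<open>Both coordinates of \<open>t\<close> lie between \<open>-(R + 1)\<close> and
    \<open>-R\<close>. A square with lower corner \<open>t\<close> and side at least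
    \<open>2 * R + 1\<close> therefore contains all values of the pair.\<close>
  then obtain t where t: "t \<in> cbox (- (\<chi> i. R + 1)) (- (\<chi> i. R + 1) + 1)"
    "\<And>i. i \<in> {..N} \<times> {..N} \<Longrightarrow> t + ?v i \<notin> pair_map F G ` topspace M"
    using translated_lattice_avoids[of "pair_map F G ` topspace M" "{..N} \<times> {..N}"
        "- (\<chi> i. R + 1)" ?v] K by auto
  have tb: "- (R + 1) \<le> t $ i" "t $ i \<le> - R" for i
    using t(1) by (auto simp: mem_box_cart)
  \<comment> \<open>Coordinates in which the translated lattice of mesh \<open>d * pi\<close>
    becomes the multiples of pi: \<open>f\<close> is \<open>(F - t $ 1) / d\<close>, in the form
    that \<open>smooth_function_cmult_add\<close> accepts.\<close>
  define f where "f p = - (t $ 1 / d) + inverse d * F p" for p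
  define g where "g p = - (t $ 2 / d) + inverse d * G p" for p
  have Ff: "F p = t $ 1 + d * f p" and Gg: "G p = t $ 2 + d * g p" for p
    using d(1) by (simp_all add: f_def g_def algebra_simps)
  have sm: "smooth_function A f" "smooth_function A g"
    unfolding f_def g_def by (intro smooth_function_cmult_add[OF A] FG)+
  have fg: "0 \<le> f p" "f p \<le> real N * pi" "0 \<le> g p" "g p \<le> real N * pi" if p: "p \<in> topspace M" for p
  proof -
    have "0 \<le> d * f p" "d * f p \<le> d * (real N * pi)" "0 \<le> d * g p" "d * g p \<le> d * (real N * pi)"
      using R[OF p] tb[of 1] tb[of 2] d(2) Ff[of p] Gg[of p] by linarith+
    then show "0 \<le> f p" "f p \<le> real N * pi" "0 \<le> g p" "g p \<le> real N * pi"
      using d(1) by (auto simp: zero_le_mult_iff)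
  qed
  have nz: "sin (f p) \<noteq> 0 \<or> sin (g p) \<noteq> 0" if p: "p \<in> topspace M" for p
  proof (rule ccontr)
    assume "\<not> ?thesis"
    then obtain i j where ij: "i \<le> N" "f p = real i * pi" "j \<le> N" "g p = real j * pi"
      \<comment> \<open>The bounds on \<open>f p\<close> and \<open>g p\<close> keep both indices
        between 0 and \<open>N\<close>, so the point is one of the finitely many that
        \<open>t\<close> was chosen to avoid.\<close>
      using fg[OF p] sin_eq_0_nat by metis
    have "t + ?v (i, j) = pair_map F G p"
      using Ff[of p] Gg[of p] ij by (simp add: vec_eq_iff forall_2 pair_map_nth)
    then show False using t(2)[of "(i, j)"] ij p by auto
  qed
  show thesis
  proof (rule that[of "\<lambda>p. t $ 1 + d * stair N (f p) (g p)" "\<lambda>p. t $ 2 + d * stair N (g p) (f p)"])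
    show "smooth_function A (\<lambda>p. t $ 1 + d * stair N (f p) (g p))"
      "smooth_function A (\<lambda>p. t $ 2 + d * stair N (g p) (f p))"
      using nz by (auto intro!: smooth_function_cmult_add[OF A] smooth_function_stair[OF A] sm)
    fix p assume p: "p \<in> topspace M"
    show "\<bar>t $ 1 + d * stair N (f p) (g p) - F p\<bar> \<le> 6 * d"
      "\<bar>t $ 2 + d * stair N (g p) (f p) - G p\<bar> \<le> 6 * d"
      using mult_left_mono[OF stair_approx[OF fg(1,2)[OF p], of "g p"], of d]
        mult_left_mono[OF stair_approx[OF fg(3,4)[OF p], of "f p"], of d] d(1)
      by (simp_all add: Ff Gg abs_mult_pos' algebra_simps flip: abs_mult_pos)
    show "poisson_bracket A \<omega> (\<lambda>p. t $ 1 + d * stair N (f p) (g p))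
        (\<lambda>p. t $ 2 + d * stair N (g p) (f p)) p = 0"
      by (rule poisson_bracket_stair[OF M sm nz p])
  qed
qed

lemma poisson_commute_approx:
  assumes M: "closed_surface M A" "area_form A \<omega>"
    and cont: "continuous_map M euclideanreal F" "continuous_map M euclideanreal G"
    and PC: "poisson_commute M A \<omega> F G" and e: "e > 0"
  shows "\<exists>F' G'. smooth_function A F' \<and> smooth_function A G' \<and>
    (\<forall>p\<in>topspace M. \<bar>F' p - F p\<bar> < e) \<and> (\<forall>p\<in>topspace M. \<bar>G' p - G p\<bar> < e) \<and>
    (\<forall>p\<in>topspace M. poisson_bracket A \<omega> F' G' p = 0)"
proof -
  obtain Fk Gk where sm: "\<And>k::nat. smooth_function A (Fk k)" "\<And>k. smooth_function A (Gk k)"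
    and lim: "uniform_limit (topspace M) Fk F sequentially" "uniform_limit (topspace M) Gk G sequentially"
      "uniform_limit (topspace M) (\<lambda>k. poisson_bracket A \<omega> (Fk k) (Gk k)) (\<lambda>_. 0) sequentially"
    using PC unfolding poisson_commute_def by blast
  obtain C where C: "C \<ge> 0"
    "\<And>F G e. smooth_function A F \<Longrightarrow> smooth_function A G \<Longrightarrow>
      (\<And>q. q \<in> topspace M \<Longrightarrow> \<bar>poisson_bracket A \<omega> F G q\<bar> \<le> e) \<Longrightarrow> e \<ge> 0 \<Longrightarrow>
      pair_map F G ` topspace M \<in> lmeasurable \<and>
      measure lebesgue (pair_map F G ` topspace M) \<le> C * e"
    using measure_pair_map_bound[OF M] by blast
  have bounded: "\<exists>B. \<forall>p\<in>topspace M. \<bar>H p\<bar> \<le> B" if "continuous_map M euclideanreal H" for H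
  proof -
    have "compactin euclideanreal (H ` topspace M)"
      using M(1) that image_compactin unfolding closed_surface_def compact_space_def by blast
    then have "bounded (H ` topspace M)" by (simp add: compact_imp_bounded)
    then show ?thesis by (auto simp: bounded_iff)
  qed
  obtain B1 B2 where B: "\<And>p. p \<in> topspace M \<Longrightarrow> \<bar>F p\<bar> \<le> B1" "\<And>p. p \<in> topspace M \<Longrightarrow> \<bar>G p\<bar> \<le> B2"
    using bounded[OF cont(1)] bounded[OF cont(2)] by blast
  \<comment> \<open>The extra 1 covers the distance from \<open>F\<close>, \<open>G\<close> to the
    chosen approximants, which explains the \<open>min 1\<close> below.\<close>
  define R where "R = max B1 B2 + 1"
  \<comment> \<open>The collapse costs \<open>6 * d\<close>, half of \<open>e\<close>; the other
    half is spent on replacing \<open>F\<close>, \<open>G\<close> by \<open>Fk k\<close>,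
    \<open>Gk k\<close>.\<close>
  define d where "d = e / 12"
  have d: "d > 0" using e by (simp add: d_def)
  obtain N :: nat where N: "(2 * R + 1) / (d * pi) < real N"
    using reals_Archimedean2 by blast
  then have N': "2 * R + 1 \<le> d * (real N * pi)"
    using d pi_gt_zero by (simp add: divide_less_eq mult_ac)
  \<comment> \<open>There are \<open>(N + 1)\<^sup>2\<close> lattice points, and a bracket below
    \<open>h\<close> gives an image of area at most \<open>C * h\<close>, so the total is at most
    \<open>C / (C + 1)\<close>. Adding 1 to \<open>C\<close> makes this strictly less than 1 and
    covers \<open>C = 0\<close>.\<close>
  define h where "h = 1 / ((real N + 1)\<^sup>2 * (C + 1))"
  have h: "h > 0" using C(1) by (simp add: h_def)
  have "\<forall>\<^sub>F k in sequentially. (\<forall>p\<in>topspace M. dist (Fk k p) (F p) < min 1 (e / 2)) \<and>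
      (\<forall>p\<in>topspace M. dist (Gk k p) (G p) < min 1 (e / 2)) \<and>
      (\<forall>p\<in>topspace M. dist (poisson_bracket A \<omega> (Fk k) (Gk k) p) 0 < h)"
    by (intro eventually_conj uniform_limitD[OF lim(1)] uniform_limitD[OF lim(2)] uniform_limitD[OF lim(3)])
       (use h e in auto)
  from eventually_happens'[OF sequentially_bot this]
  obtain k where k: "\<And>p. p \<in> topspace M \<Longrightarrow> \<bar>Fk k p - F p\<bar> < min 1 (e / 2)"
    "\<And>p. p \<in> topspace M \<Longrightarrow> \<bar>Gk k p - G p\<bar> < min 1 (e / 2)"
    "\<And>p. p \<in> topspace M \<Longrightarrow> \<bar>poisson_bracket A \<omega> (Fk k) (Gk k) p\<bar> < h"
    unfolding dist_real_def diff_0_right by blast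
  have K: "pair_map (Fk k) (Gk k) ` topspace M \<in> lmeasurable"
    "measure lebesgue (pair_map (Fk k) (Gk k) ` topspace M) \<le> C * h"
    using C(2)[OF sm(1)[of k] sm(2)[of k], of h] k(3) h by (auto intro: less_imp_le)
  have "(real N + 1)\<^sup>2 * measure lebesgue (pair_map (Fk k) (Gk k) ` topspace M) \<le>
      (real N + 1)\<^sup>2 * (C * h)"
    using K(2) by (intro mult_left_mono) auto
  also have "\<dots> < 1" using C(1) by (simp add: h_def)
  finally have K': "(real N + 1)\<^sup>2 * measure lebesgue (pair_map (Fk k) (Gk k) ` topspace M) < 1" .
  have R: "\<bar>Fk k p\<bar> \<le> R" "\<bar>Gk k p\<bar> \<le> R" if "p \<in> topspace M" for p
    using B[OF that] k(1,2)[OF that] unfolding R_def by linarith+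
  obtain F' G' where F': "smooth_function A F'" "smooth_function A G'"
    "\<And>p. p \<in> topspace M \<Longrightarrow> \<bar>F' p - Fk k p\<bar> \<le> 6 * d"
    "\<And>p. p \<in> topspace M \<Longrightarrow> \<bar>G' p - Gk k p\<bar> \<le> 6 * d"
    "\<And>p. p \<in> topspace M \<Longrightarrow> poisson_bracket A \<omega> F' G' p = 0"
    using exists_commuting_near[OF M sm(1)[of k] sm(2)[of k] R d N' K(1) K'] by blast
  have "\<bar>F' p - F p\<bar> < e" "\<bar>G' p - G p\<bar> < e" if "p \<in> topspace M" for p
    using F'(3,4)[OF that] k(1,2)[OF that] unfolding d_def by linarith+
  then show ?thesis using F' by blast
qed

lemma uniform_limit_real_inverse_Suc:
  fixes f :: "nat \<Rightarrow> 'a \<Rightarrow> real"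
  assumes "\<And>k x. x \<in> S \<Longrightarrow> \<bar>f k x - l x\<bar> < inverse (real (Suc k))"
  shows "uniform_limit S f l sequentially"
  unfolding uniform_limit_iff
proof (intro allI impI)
  fix e :: real assume "e > 0"
  then have "\<forall>\<^sub>F k in sequentially. inverse (real (Suc k)) < e"
    using LIMSEQ_inverse_real_of_nat by (rule order_tendstoD(2)[rotated])
  then show "\<forall>\<^sub>F k in sequentially. \<forall>x\<in>S. dist (f k x) (l x) < e"
    by eventually_elim (use assms in \<open>fastforce simp: dist_real_def intro: less_trans\<close>)
qed

theorem corollary1p6:
  fixes M :: "'a topology" and A :: "'a chart set" and \<omega> :: "'a form2"
    and F G :: "'a \<Rightarrow> real"
  assumes "closed_surface M A" and "area_form A \<omega>"
    and "continuous_map M euclideanreal F" and "continuous_map M euclideanreal G"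
  shows "poisson_commute M A \<omega> F G \<longleftrightarrow>
    (\<exists>Fk Gk :: nat \<Rightarrow> 'a \<Rightarrow> real.
       (\<forall>k. smooth_function A (Fk k)) \<and> (\<forall>k. smooth_function A (Gk k)) \<and>
       uniform_limit (topspace M) Fk F sequentially \<and>
       uniform_limit (topspace M) Gk G sequentially \<and>
       (\<forall>k. \<forall>p\<in>topspace M. poisson_bracket A \<omega> (Fk k) (Gk k) p = 0))"
    (is "_ \<longleftrightarrow> ?rhs")
proof
  assume PC: "poisson_commute M A \<omega> F G"
  have "\<forall>k. \<exists>F' G'. smooth_function A F' \<and> smooth_function A G' \<and>
      (\<forall>p\<in>topspace M. \<bar>F' p - F p\<bar> < inverse (real (Suc k))) \<and>
      (\<forall>p\<in>topspace M. \<bar>G' p - G p\<bar> < inverse (real (Suc k))) \<and>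
      (\<forall>p\<in>topspace M. poisson_bracket A \<omega> F' G' p = 0)"
    by (intro allI poisson_commute_approx[OF assms PC]) simp
  then obtain Fk Gk where "\<forall>k. smooth_function A (Fk k) \<and> smooth_function A (Gk k) \<and>
      (\<forall>p\<in>topspace M. \<bar>Fk k p - F p\<bar> < inverse (real (Suc k))) \<and>
      (\<forall>p\<in>topspace M. \<bar>Gk k p - G p\<bar> < inverse (real (Suc k))) \<and>
      (\<forall>p\<in>topspace M. poisson_bracket A \<omega> (Fk k) (Gk k) p = 0)"
    by metis
  then show ?rhs
    using uniform_limit_real_inverse_Suc[of "topspace M" Fk F]
      uniform_limit_real_inverse_Suc[of "topspace M" Gk G] by blast
next
  assume ?rhs
  then obtain Fk Gk :: "nat \<Rightarrow> 'a \<Rightarrow> real" where *: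
    "\<forall>k. smooth_function A (Fk k)" "\<forall>k. smooth_function A (Gk k)"
    "uniform_limit (topspace M) Fk F sequentially" "uniform_limit (topspace M) Gk G sequentially"
    "\<forall>k. \<forall>p\<in>topspace M. poisson_bracket A \<omega> (Fk k) (Gk k) p = 0" by blast
  moreover have "uniform_limit (topspace M) (\<lambda>k. poisson_bracket A \<omega> (Fk k) (Gk k)) (\<lambda>_. 0) sequentially"
    using *(5) by (simp add: uniform_limit_iff)
  ultimately show "poisson_commute M A \<omega> F G" unfolding poisson_commute_def by blast
qed

end
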